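(* Let $G=(V,E)$ be a finite simple graph whose edges have been randomly and independently oriented. Then, for any source set $S\subset V$, the events $\{S \leadsto i\}$, $i\in V$, are positively associated; that is, writing $\mathbf{X}=(\mathbf{1}_{\{S\leadsto i\}})_{i\in V}$, for all increasing functions $f,g\colon \mathbb{R}^V\to\mathbb{R}$, $$\mathbb{E}\big[f(\mathbf{X})\,g(\mathbf{X})\big]\;\geq\;\mathbb{E}\big[f(\mathbf{X})\big]\,\mathbb{E}\big[g(\mathbf{X})\big].$$
   Context: Randomly and independently oriented edges: on some probability space we are given events $\{i\to j\}$ and $\{j\to i\}$ for each edge $\{ij\}\in E$ (meaning that the edge is oriented towards $j$, respectively towards $i$), such that $\{i\to j\}$ is the complement of $\{j\to i\}$, and such that for every edge $\{ij\}$ the event $\{i\to j\}$ is independent of the family of the events $\{k\to\ell\}$, $\{k\ell\}\in E$, $\{k\ell\}\neq\{ij\}$ (so the orientations of distinct edges are mutually independent). The orientations need not be unbiased: the probability of $\{i\to j\}$ is arbitrary and may depend on the edge. For vertices $i,j$, $\{i\leadsto j\}$ is the event that there is an oriented path from $i$ to $j$ (a path of length zero is allowed, so $\{i\leadsto i\}$ is certain). For $S\subset V$, $\{S\leadsto i\}=\bigcup_{j\in S}\{j\leadsto i\}$. For vectors, $\mathbf{x}\leq\mathbf{x}'$ means $x_i\leq x'_i$ for all $i$; a function $f\colon\mathbb{R}^V\to\mathbb{R}$ is increasing if $\mathbf{x}\leq\mathbf{x}'$ implies $f(\mathbf{x})\leq f(\mathbf{x}')$. A random vector $\mathbf{X}=(X_i)_{i\in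 I}$ is positively associated if $\mathbb{E}[f(\mathbf{X})g(\mathbf{X})]\geq\mathbb{E}[f(\mathbf{X})]\,\mathbb{E}[g(\mathbf{X})]$ for all increasing $f,g\colon\mathbb{R}^I\to\mathbb{R}$ for which these expectations exist; events $A_i$, $i\in I$, are positively associated if the vector of indicators $(\mathbf{1}_{A_i})_{i\in I}$ is. *)

theory Defs
  imports "HOL-Probability.Probability" "Graph_Theory.Pair_Digraph"
begin

text \<open>
  A finite simple graph is a \<open>pair_graph\<close>: a finite, loop-free, symmetric relation on a finite
  vertex set, so that an undirected edge is present as both arcs \<open>(i, j)\<close> and \<open>(j, i)\<close>.
  \<open>D i j\<close> is the event that the edge between \<open>i\<close> and \<open>j\<close> is oriented towards \<open>j\<close>; only its values
  at the arcs of the graph matter.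
\<close>

locale random_orientation = prob_space M + pair_graph G
  for M :: "'w measure" and G :: "'v pair_pre_digraph" +
  fixes D :: "'v \<Rightarrow> 'v \<Rightarrow> 'w set"
  assumes orient_event: "(i, j) \<in> parcs G \<Longrightarrow> D i j \<in> events"
    and orient_compl: "(i, j) \<in> parcs G \<Longrightarrow> D i j = space M - D j i"
    and orient_indep: "(i, j) \<in> parcs G \<Longrightarrow>
      indep_set {D i j}
        (sigma_sets (space M) {D k l | k l. (k, l) \<in> parcs G \<and> {k, l} \<noteq> {i, j}})"

definition oriented_graph ::
    "'v pair_pre_digraph \<Rightarrow> ('v \<Rightarrow> 'v \<Rightarrow> 'w set) \<Rightarrow> 'w \<Rightarrow> 'v pair_pre_digraph" where
  "oriented_graph G D \<omega> = \<lparr>pverts = pverts G, parcs = {(i, j) \<in> parcs G. \<omega> \<in> D i j}\<rparr>"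

definition leads_to ::
    "'w measure \<Rightarrow> 'v pair_pre_digraph \<Rightarrow> ('v \<Rightarrow> 'v \<Rightarrow> 'w set) \<Rightarrow> 'v \<Rightarrow> 'v \<Rightarrow> 'w set" where
  "leads_to M G D i j =
    {\<omega> \<in> space M. \<exists>p. pre_digraph.apath (with_proj (oriented_graph G D \<omega>)) i p j}"

definition set_leads_to ::
    "'w measure \<Rightarrow> 'v pair_pre_digraph \<Rightarrow> ('v \<Rightarrow> 'v \<Rightarrow> 'w set) \<Rightarrow> 'v set \<Rightarrow> 'v \<Rightarrow> 'w set" where
  "set_leads_to M G D S i = (\<Union>j\<in>S. leads_to M G D j i)"

text \<open>
  The space of real vectors indexed by a set \<open>I\<close> is \<open>I \<rightarrow>\<^sub>E UNIV\<close>. On it the pointwise order of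
  functions is the coordinatewise order over \<open>I\<close>, since all its elements agree outside \<open>I\<close>.
\<close>

abbreviation increasing_on_vectors :: "'i set \<Rightarrow> (('i \<Rightarrow> real) \<Rightarrow> real) \<Rightarrow> bool" where
  "increasing_on_vectors I f \<equiv> mono_on (I \<rightarrow>\<^sub>E (UNIV :: real set)) f"

definition random_vector :: "'i set \<Rightarrow> ('i \<Rightarrow> 'w \<Rightarrow> real) \<Rightarrow> 'w \<Rightarrow> 'i \<Rightarrow> real" where
  "random_vector I X \<omega> = (\<lambda>i\<in>I. X i \<omega>)"

definition positively_associated :: "'w measure \<Rightarrow> 'i set \<Rightarrow> ('i \<Rightarrow> 'w \<Rightarrow> real) \<Rightarrow> bool" where
  "positively_associated M I X \<longleftrightarrow>
    (\<forall>i\<in>I. X i \<in> borel_measurable M) \<and>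
    (\<forall>f g. increasing_on_vectors I f \<longrightarrow> increasing_on_vectors I g \<longrightarrow>
      integrable M (\<lambda>\<omega>. f (random_vector I X \<omega>)) \<longrightarrow>
      integrable M (\<lambda>\<omega>. g (random_vector I X \<omega>)) \<longrightarrow>
      integrable M (\<lambda>\<omega>. f (random_vector I X \<omega>) * g (random_vector I X \<omega>)) \<longrightarrow>
      (\<integral>\<omega>. f (random_vector I X \<omega>) * g (random_vector I X \<omega>) \<partial>M)
        \<ge> (\<integral>\<omega>. f (random_vector I X \<omega>) \<partial>M) * (\<integral>\<omega>. g (random_vector I X \<omega>) \<partial>M))"

definition positively_associated_events :: "'w measure \<Rightarrow> 'i set \<Rightarrow> ('i \<Rightarrow> 'w set) \<Rightarrow> bool" where
  "positively_associated_events M I A \<longleftrightarrow> positively_associated M I (\<lambda>i. indicator (A i))"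

end

theory Submission
  imports Defs
begin

text \<open>
  The proof reveals edges at the boundary of the source set, by induction on the number of edges
  still unrevealed. Let \<open>F\<close> be the set of their arcs and suppose that an edge of \<open>F\<close> joins some
  \<open>s \<in> S\<close> to a vertex \<open>v\<close>. If it is oriented towards \<open>v\<close>, the set reached from \<open>S\<close> is the set
  reached from \<open>insert v S\<close> by the remaining edges; if it is oriented towards \<open>s\<close>, it leads back
  into \<open>S\<close> and can be discarded, so the set reached is the one reached from \<open>S\<close> by the
  remaining edges. The remaining edges are independent of this one. Hence the law of the reached
  set is a mixture, with weights \<open>p\<close> and \<open>1 - p\<close>, of the laws for the sources \<open>insert v S\<close> and
  \<open>S\<close> in a smaller graph.

  Both component laws have positively correlated increasing functions by induction. The mean of
  an increasing function is at least as large under the first component as under the second,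
  because there the reached set is pointwise larger. So the conditional means of two increasing
  functions move in the same direction when the edge is revealed, and the mixture inherits
  positive correlation (\<open>mixture_of_ordered_means\<close>). When no unrevealed edge leaves \<open>S\<close>, the
  reached set is the constant \<open>S\<close>. The induction is \<open>reached_set_positively_correlated\<close>; the
  conditioning on one edge is \<open>expectation_condition_on_edge\<close>.

  The argument is asymmetric in the two orientations: it works because the orientation towards
  \<open>s\<close> neither helps nor hinders, although it excludes the other one. This is why events that are
  not increasing functions of independent variables are nevertheless positively associated.
\<close>

section \<open>Reachability after orienting one edge\<close>

lemma rtrancl_Image_insert_source:
  assumes "s \<in> S"
  shows "(insert (s, v) C)\<^sup>* `` S = C\<^sup>* `` insert v S"
  using assms by (auto simp: rtrancl_insert)

text \<open>
  An arc into the source set is of no use: a path that runs through it can be cut at its last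
  visit to \<open>S\<close>.
\<close>

lemma rtrancl_Image_insert_into_source:
  assumes "s \<in> S"
  shows "(insert (v, s) C)\<^sup>* `` S = C\<^sup>* `` S"
  using assms by (auto simp: rtrancl_insert)

lemma rtrancl_Image_closed:
  assumes "C `` S \<subseteq> S"
  shows "C\<^sup>* `` S = S"
proof -
  have "y \<in> S" if "(x, y) \<in> C\<^sup>*" "x \<in> S" for x y
    using that assms by (induction rule: rtrancl_induct) auto
  then show ?thesis by auto
qed

section \<open>Independence of one edge from functions of the others\<close>

context random_orientation
begin

definition oriented_arcs :: "('v \<times> 'v) set \<Rightarrow> 'w \<Rightarrow> ('v \<times> 'v) set" where
  "oriented_arcs F \<omega> = {(i, j) \<in> F. \<omega> \<in> D i j}"

lemma oriented_arcs_subset: "oriented_arcs F \<omega> \<subseteq> F"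
  by (auto simp: oriented_arcs_def)

text \<open>
  The measurable space \<open>N\<close> is a parameter because the event is needed both in \<open>M\<close> and in the
  smaller sigma-algebra generated by the edges other than a given one.
\<close>

lemma oriented_arcs_eq_set:
  assumes "finite F" "C \<subseteq> F" "\<And>i j. (i, j) \<in> F \<Longrightarrow> D i j \<in> sets N"
  shows "{\<omega> \<in> space N. oriented_arcs F \<omega> = C} \<in> sets N"
proof -
  have "{\<omega> \<in> space N. oriented_arcs F \<omega> = C}
      = {\<omega> \<in> space N. \<forall>e\<in>F. \<omega> \<in> D (fst e) (snd e) \<longleftrightarrow> e \<in> C}"
    using assms(2) by (fastforce simp: oriented_arcs_def)
  also have "\<dots> \<in> sets N"
  proof (rule sets.sets_Collect_finite_All)
    fix e assume "e \<in> F"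
    then have [measurable]: "D (fst e) (snd e) \<in> sets N"
      using assms(3)[of "fst e" "snd e"] by simp
    show "{\<omega> \<in> space N. \<omega> \<in> D (fst e) (snd e) \<longleftrightarrow> e \<in> C} \<in> sets N"
      by measurable
  qed (rule assms(1))
  finally show ?thesis .
qed

lemma oriented_arcs_event:
  assumes "F \<subseteq> parcs G"
  shows "{\<omega> \<in> space M. oriented_arcs F \<omega> = C} \<in> events"
proof (cases "C \<subseteq> F")
  case True
  then show ?thesis
    using assms finite_subset[OF assms pair_finite_arcs] orient_event
    by (intro oriented_arcs_eq_set) auto
next
  case False
  then have "{\<omega> \<in> space M. oriented_arcs F \<omega> = C} = {}"
    using oriented_arcs_subset by auto
  then show ?thesis by (simp only: sets.empty_sets)
qed

text \<open>
  There are finitely many configurations, so every function of the orientation of \<open>F\<close> is a simple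
  function. Integrability and factorisation of expectations reduce to statements about the
  events of single configurations.
\<close>

lemma function_of_oriented_arcs_expand:
  fixes \<psi> :: "('v \<times> 'v) set \<Rightarrow> real"
  assumes "F \<subseteq> parcs G" "\<omega> \<in> space M"
  shows "\<psi> (oriented_arcs F \<omega>) =
    (\<Sum>C\<in>Pow F. \<psi> C * indicator {\<omega> \<in> space M. oriented_arcs F \<omega> = C} \<omega>)"
proof -
  have "finite F" using assms(1) pair_finite_arcs by (rule finite_subset)
  then have "(\<Sum>C\<in>Pow F. \<psi> C * indicator {\<omega> \<in> space M. oriented_arcs F \<omega> = C} \<omega>)
      = (\<Sum>C\<in>Pow F. if C = oriented_arcs F \<omega> then \<psi> C else 0)"
    using assms(2) by (intro sum.cong) (auto simp: indicator_def)
  also have "\<dots> = \<psi> (oriented_arcs F \<omega>)"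
    using \<open>finite F\<close> oriented_arcs_subset[of F \<omega>] by simp
  finally show ?thesis by simp
qed

lemma integrable_function_of_oriented_arcs:
  fixes \<psi> :: "('v \<times> 'v) set \<Rightarrow> real"
  assumes "F \<subseteq> parcs G"
  shows "integrable M (\<lambda>\<omega>. \<psi> (oriented_arcs F \<omega>))"
proof -
  have "integrable M (\<lambda>\<omega>. \<Sum>C\<in>Pow F. \<psi> C * indicator {\<omega> \<in> space M. oriented_arcs F \<omega> = C} \<omega>)"
    using oriented_arcs_event[OF assms]
    by (intro Bochner_Integration.integrable_sum integrable_mult_right integrable_real_indicator)
       (auto simp: less_top[symmetric])
  then show ?thesis
    using function_of_oriented_arcs_expand[OF assms, of _ \<psi>]
    by (subst Bochner_Integration.integrable_cong[OF refl]) auto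
qed

text \<open>
  The event that the edges of \<open>F\<close> have a given configuration lies in the sigma-algebra of the
  edges other than \<open>{i, j}\<close>, so the independence hypothesis applies to it; summing over
  configurations gives the factorisation for a general function.
\<close>

lemma expectation_indicator_times_other_arcs:
  fixes \<psi> :: "('v \<times> 'v) set \<Rightarrow> real"
  assumes arc: "(i, j) \<in> parcs G"
    and F: "F \<subseteq> parcs G" "(i, j) \<notin> F" "(j, i) \<notin> F"
  shows "(\<integral>\<omega>. indicator (D i j) \<omega> * \<psi> (oriented_arcs F \<omega>) \<partial>M)
    = prob (D i j) * (\<integral>\<omega>. \<psi> (oriented_arcs F \<omega>) \<partial>M)"
proof -
  define Q where "Q C = {\<omega> \<in> space M. oriented_arcs F \<omega> = C}" for C
  define K where "K = {D k l | k l. (k, l) \<in> parcs G \<and> {k, l} \<noteq> {i, j}}"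
  have fin: "finite F" using F(1) pair_finite_arcs by (rule finite_subset)
  have D[measurable]: "D i j \<in> events" using arc by (rule orient_event)
  have Q[measurable]: "Q C \<in> events" for C
    unfolding Q_def by (rule oriented_arcs_event[OF F(1)])
  have K: "K \<subseteq> Pow (space M)"
    using sets.sets_into_space[OF orient_event] by (auto simp: K_def)
  have indep: "prob (D i j \<inter> Q C) = prob (D i j) * prob (Q C)" if "C \<subseteq> F" for C
  proof (rule indep_setD[OF orient_indep[OF arc]])
    have "D k l \<in> K" if "(k, l) \<in> F" for k l
      using that F unfolding K_def doubleton_eq_iff by auto
    then have "{\<omega> \<in> space (sigma (space M) K). oriented_arcs F \<omega> = C} \<in> sets (sigma (space M) K)"
      using fin \<open>C \<subseteq> F\<close> K by (intro oriented_arcs_eq_set) auto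
    then show "Q C \<in> sigma_sets (space M) {D k l | k l. (k, l) \<in> parcs G \<and> {k, l} \<noteq> {i, j}}"
      using K by (simp add: Q_def K_def)
  qed simp
  have ind: "integrable M (\<lambda>\<omega>. indicator A \<omega> :: real)" if "A \<in> events" for A
    using that by (simp add: less_top[symmetric])
  have "(\<integral>\<omega>. indicator (D i j) \<omega> * \<psi> (oriented_arcs F \<omega>) \<partial>M)
      = (\<integral>\<omega>. (\<Sum>C\<in>Pow F. \<psi> C * indicator (D i j \<inter> Q C) \<omega>) \<partial>M)"
    using function_of_oriented_arcs_expand[OF F(1), of _ \<psi>]
    by (intro Bochner_Integration.integral_cong)
       (auto simp: Q_def sum_distrib_left indicator_inter_arith mult_ac)
  also have "\<dots> = (\<Sum>C\<in>Pow F. \<psi> C * prob (D i j \<inter> Q C))"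
    by (subst Bochner_Integration.integral_sum)
       (auto intro!: integrable_mult_right ind sum.cong simp: Int_absorb2 sets.sets_into_space)
  also have "\<dots> = prob (D i j) * (\<Sum>C\<in>Pow F. \<psi> C * prob (Q C))"
    using indep by (auto simp: sum_distrib_left mult_ac intro!: sum.cong)
  also have "(\<Sum>C\<in>Pow F. \<psi> C * prob (Q C)) = (\<integral>\<omega>. (\<Sum>C\<in>Pow F. \<psi> C * indicator (Q C) \<omega>) \<partial>M)"
    by (subst Bochner_Integration.integral_sum)
       (auto intro!: integrable_mult_right ind sum.cong simp: Int_absorb2 sets.sets_into_space)
  also have "\<dots> = (\<integral>\<omega>. \<psi> (oriented_arcs F \<omega>) \<partial>M)"
    using function_of_oriented_arcs_expand[OF F(1), of _ \<psi>]
    by (intro Bochner_Integration.integral_cong) (auto simp: Q_def)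
  finally show ?thesis .
qed

text \<open>
  The law of total expectation for the two orientations of an edge. Exactly one of its arcs is
  present, and by independence the conditional law of the other edges is the unconditional one.
\<close>

lemma expectation_condition_on_edge:
  fixes \<psi> :: "('v \<times> 'v) set \<Rightarrow> real"
  assumes arc: "(i, j) \<in> parcs G"
    and F: "F \<subseteq> parcs G" "(i, j) \<in> F" "(j, i) \<in> F"
  defines "F' \<equiv> F - {(i, j), (j, i)}"
  shows "(\<integral>\<omega>. \<psi> (oriented_arcs F \<omega>) \<partial>M)
    = prob (D i j) * (\<integral>\<omega>. \<psi> (insert (i, j) (oriented_arcs F' \<omega>)) \<partial>M)
      + (1 - prob (D i j)) * (\<integral>\<omega>. \<psi> (insert (j, i) (oriented_arcs F' \<omega>)) \<partial>M)"
proof -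
  have arc': "(j, i) \<in> parcs G" using F by auto
  have F': "F' \<subseteq> parcs G" "(i, j) \<notin> F'" "(j, i) \<notin> F'" using F by (auto simp: F'_def)
  have [measurable]: "D i j \<in> events" "D j i \<in> events"
    using arc arc' by (auto intro: orient_event)
  have compl: "D j i = space M - D i j" by (rule orient_compl[OF arc'])
  have ne: "i \<noteq> j" using pair_no_loops[OF arc] by auto
  have split: "\<psi> (oriented_arcs F \<omega>)
      = indicator (D i j) \<omega> * \<psi> (insert (i, j) (oriented_arcs F' \<omega>))
        + indicator (D j i) \<omega> * \<psi> (insert (j, i) (oriented_arcs F' \<omega>))"
    if "\<omega> \<in> space M" for \<omega>
  proof (cases "\<omega> \<in> D i j")
    case True
    then have "oriented_arcs F \<omega> = insert (i, j) (oriented_arcs F' \<omega>)"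
      using F ne compl by (auto simp: oriented_arcs_def F'_def)
    then show ?thesis using True compl by simp
  next
    case False
    then have "oriented_arcs F \<omega> = insert (j, i) (oriented_arcs F' \<omega>)"
      using F ne compl that by (auto simp: oriented_arcs_def F'_def)
    then show ?thesis using False compl that by simp
  qed
  have int: "integrable M (\<lambda>\<omega>. indicator A \<omega> * \<psi> (insert e (oriented_arcs F' \<omega>)))"
    if "A \<in> events" for A e
    using integrable_mult_indicator[OF that
        integrable_function_of_oriented_arcs[OF F'(1), of "\<lambda>C. \<psi> (insert e C)"]]
    by simp
  have "(\<integral>\<omega>. \<psi> (oriented_arcs F \<omega>) \<partial>M)
      = (\<integral>\<omega>. indicator (D i j) \<omega> * \<psi> (insert (i, j) (oriented_arcs F' \<omega>)) \<partial>M)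
        + (\<integral>\<omega>. indicator (D j i) \<omega> * \<psi> (insert (j, i) (oriented_arcs F' \<omega>)) \<partial>M)"
    by (subst Bochner_Integration.integral_add[symmetric])
       (auto intro!: int split Bochner_Integration.integral_cong)
  moreover have "prob (D j i) = 1 - prob (D i j)"
    unfolding compl by (rule prob_compl) simp
  ultimately show ?thesis
    using expectation_indicator_times_other_arcs[OF arc F', of "\<lambda>C. \<psi> (insert (i, j) C)"]
      expectation_indicator_times_other_arcs[OF arc' F'(1,3,2), of "\<lambda>C. \<psi> (insert (j, i) C)"]
    by simp
qed

end

section \<open>Positive correlation of increasing functions of the reached set\<close>

text \<open>
  This is the law of total covariance for a two-valued condition: \<open>c - a b\<close> and \<open>c' - a' b'\<close> are
  the conditional covariances, and the covariance of the conditional means is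
  \<open>p (1 - p) (a - a') (b - b')\<close>, which is nonnegative because both means are larger in the
  same component.
\<close>

lemma mixture_of_ordered_means:
  fixes p :: real
  assumes p: "0 \<le> p" "p \<le> 1"
    and prod: "a * b \<le> c" "a' * b' \<le> c'"
    and ordered: "a' \<le> a" "b' \<le> b"
  shows "(p * a + (1 - p) * a') * (p * b + (1 - p) * b') \<le> p * c + (1 - p) * c'"
proof -
  have "p * (a * b) + (1 - p) * (a' * b')
      - (p * a + (1 - p) * a') * (p * b + (1 - p) * b') = p * (1 - p) * ((a - a') * (b - b'))"
    by (simp add: algebra_simps)
  also have "\<dots> \<ge> 0" using p ordered by simp
  finally have "(p * a + (1 - p) * a') * (p * b + (1 - p) * b')
      \<le> p * (a * b) + (1 - p) * (a' * b')" by simp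
  also have "\<dots> \<le> p * c + (1 - p) * c'"
    using p prod by (intro add_mono mult_left_mono) auto
  finally show ?thesis .
qed

context random_orientation
begin

text \<open>
  The source set \<open>S\<close> varies in the induction, since it grows whenever a revealed edge points out
  of it. Symmetry of \<open>F\<close> says that both arcs of an edge are unrevealed together.
\<close>

lemma reached_set_positively_correlated:
  fixes \<phi> \<gamma> :: "'v set \<Rightarrow> real"
  assumes "mono \<phi>" "mono \<gamma>"
    and "F \<subseteq> parcs G" "sym F"
  shows "(\<integral>\<omega>. \<phi> ((oriented_arcs F \<omega>)\<^sup>* `` S) \<partial>M) * (\<integral>\<omega>. \<gamma> ((oriented_arcs F \<omega>)\<^sup>* `` S) \<partial>M)
    \<le> (\<integral>\<omega>. \<phi> ((oriented_arcs F \<omega>)\<^sup>* `` S) * \<gamma> ((oriented_arcs F \<omega>)\<^sup>* `` S) \<partial>M)"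
  using assms(3,4)
proof (induction "card F" arbitrary: F S rule: less_induct)
  case less
  show ?case
  proof (cases "F `` S \<subseteq> S")
    case True
    then have "(oriented_arcs F \<omega>)\<^sup>* `` S = S" for \<omega>
      using oriented_arcs_subset[of F \<omega>] by (intro rtrancl_Image_closed) auto
    then show ?thesis by (simp add: prob_space)
  next
    case False
    then obtain s v where sv: "(s, v) \<in> F" "s \<in> S" by auto
    have vs: "(v, s) \<in> F" using sv(1) less.prems(2) by (auto dest: symD)
    have arc: "(s, v) \<in> parcs G" using sv less.prems(1) by auto
    define F' where "F' = F - {(s, v), (v, s)}"
    \<comment> \<open>The set reached from \<open>T\<close> once the edge between \<open>s\<close> and \<open>v\<close> is removed.\<close>
    define R where "R T \<omega> = (oriented_arcs F' \<omega>)\<^sup>* `` T" for T \<omega>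
    have F': "F' \<subseteq> parcs G" using less.prems by (auto simp: F'_def)
    have "sym F'" using less.prems(2) by (auto simp: F'_def sym_def)
    have "finite F" using less.prems(1) pair_finite_arcs by (rule finite_subset)
    then have "card F' < card F" using sv by (intro psubset_card_mono) (auto simp: F'_def)
    note IH = less.hyps[OF this F' \<open>sym F'\<close>, folded R_def]
    have condition: "(\<integral>\<omega>. \<psi> ((oriented_arcs F \<omega>)\<^sup>* `` S) \<partial>M)
        = prob (D s v) * (\<integral>\<omega>. \<psi> (R (insert v S) \<omega>) \<partial>M)
          + (1 - prob (D s v)) * (\<integral>\<omega>. \<psi> (R S \<omega>) \<partial>M)" for \<psi> :: "'v set \<Rightarrow> real"
      using expectation_condition_on_edge[OF arc less.prems(1) sv(1) vs, of "\<lambda>C. \<psi> (C\<^sup>* `` S)"] sv(2)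
      by (simp add: F'_def R_def rtrancl_Image_insert_source rtrancl_Image_insert_into_source)
    have ordered: "(\<integral>\<omega>. \<psi> (R S \<omega>) \<partial>M) \<le> (\<integral>\<omega>. \<psi> (R (insert v S) \<omega>) \<partial>M)"
      if "mono \<psi>" for \<psi> :: "'v set \<Rightarrow> real"
      unfolding R_def
      by (intro integral_mono monoD[OF that] Image_mono subset_insertI order_refl
          integrable_function_of_oriented_arcs[OF F', of "\<lambda>C. \<psi> (C\<^sup>* `` _)"])
    show ?thesis
      unfolding condition condition[of "\<lambda>A. \<phi> A * \<gamma> A"]
      using IH[of "insert v S"] IH[of S] ordered[OF assms(1)] ordered[OF assms(2)]
      by (intro mixture_of_ordered_means) auto
  qed
qed

section \<open>The reached set as a random vector\<close>

lemma mem_set_leads_to_iff: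
  assumes "S \<subseteq> pverts G" "\<omega> \<in> space M"
  shows "\<omega> \<in> set_leads_to M G D S i \<longleftrightarrow> i \<in> (oriented_arcs (parcs G) \<omega>)\<^sup>* `` S"
proof -
  let ?H = "oriented_graph G D \<omega>"
  interpret H: pair_wf_digraph ?H
    by unfold_locales (auto simp: oriented_graph_def in_arcsD1 in_arcsD2)
  have arcs: "parcs ?H = oriented_arcs (parcs G) \<omega>" and verts: "pverts ?H = pverts G"
    by (simp_all add: oriented_graph_def oriented_arcs_def)
  have "(\<exists>p. H.apath j p i) \<longleftrightarrow> (j, i) \<in> (oriented_arcs (parcs G) \<omega>)\<^sup>*" if "j \<in> S" for j
  proof -
    have j: "j \<in> pverts ?H" using that assms(1) verts by auto
    have "(j, i) \<in> rtrancl_on (pverts ?H) (parcs ?H) \<longleftrightarrow> (j, i) \<in> (parcs ?H)\<^sup>*"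
    proof
      assume "(j, i) \<in> (parcs ?H)\<^sup>*"
      then show "(j, i) \<in> rtrancl_on (pverts ?H) (parcs ?H)"
        by (induction rule: rtrancl_induct)
           (use j in \<open>auto intro: rtrancl_on_into_rtrancl_on H.in_arcsD2\<close>)
    qed (rule rtrancl_on_rtranclI)
    then show ?thesis
      using H.reachable_apath[of j i] by (simp add: reachable_def arcs)
  qed
  then show ?thesis
    using assms(2) by (auto simp: set_leads_to_def leads_to_def)
qed

lemma set_leads_to_event:
  assumes "S \<subseteq> pverts G"
  shows "set_leads_to M G D S i \<in> events"
proof -
  have "set_leads_to M G D S i \<subseteq> space M"
    by (auto simp: set_leads_to_def leads_to_def)
  then have "set_leads_to M G D S i
      = {\<omega> \<in> space M. i \<in> (oriented_arcs (parcs G) \<omega>)\<^sup>* `` S}"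
    using mem_set_leads_to_iff[OF assms] by blast
  also have "\<dots> = (\<Union>C\<in>{C \<in> Pow (parcs G). i \<in> C\<^sup>* `` S}. {\<omega> \<in> space M. oriented_arcs (parcs G) \<omega> = C})"
    using oriented_arcs_subset[of "parcs G"] by blast
  also have "\<dots> \<in> events"
    using pair_finite_arcs by (intro sets.finite_UN) (auto intro: oriented_arcs_event)
  finally show ?thesis .
qed

lemma increasing_functions_of_set_leads_to:
  assumes S: "S \<subseteq> pverts G"
    and f: "increasing_on_vectors (pverts G) f" and g: "increasing_on_vectors (pverts G) g"
  defines "X \<equiv> random_vector (pverts G) (\<lambda>i. indicator (set_leads_to M G D S i))"
  shows "(\<integral>\<omega>. f (X \<omega>) \<partial>M) * (\<integral>\<omega>. g (X \<omega>) \<partial>M) \<le> (\<integral>\<omega>. f (X \<omega>) * g (X \<omega>) \<partial>M)"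
proof -
  define vec :: "'v set \<Rightarrow> 'v \<Rightarrow> real" where "vec A = (\<lambda>i\<in>pverts G. indicator A i)" for A
  define R where "R \<omega> = (oriented_arcs (parcs G) \<omega>)\<^sup>* `` S" for \<omega>
  have X: "X \<omega> = vec (R \<omega>)" if "\<omega> \<in> space M" for \<omega>
    using mem_set_leads_to_iff[OF S that]
    by (auto simp: X_def random_vector_def vec_def R_def indicator_def intro!: restrict_ext)
  have vec_mono: "vec A \<le> vec B" if "A \<subseteq> B" for A B
    using that by (auto simp: vec_def le_fun_def indicator_def)
  have mono: "mono (\<lambda>A. h (vec A))" if "increasing_on_vectors (pverts G) h" for h
    by (intro monoI mono_onD[OF that] vec_mono) (auto simp: vec_def)
  have "sym (parcs G)" using pair_sym_arcs by (simp add: symmetric_def)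
  from reached_set_positively_correlated[OF mono[OF f] mono[OF g] subset_refl this, of S]
  have "(\<integral>\<omega>. f (vec (R \<omega>)) \<partial>M) * (\<integral>\<omega>. g (vec (R \<omega>)) \<partial>M)
      \<le> (\<integral>\<omega>. f (vec (R \<omega>)) * g (vec (R \<omega>)) \<partial>M)"
    by (simp add: R_def)
  then show ?thesis by (simp add: X cong: Bochner_Integration.integral_cong)
qed

end

theorem theorem2p2:
  fixes M :: "'w measure" and G :: "'v pair_pre_digraph"
    and D :: "'v \<Rightarrow> 'v \<Rightarrow> 'w set" and S :: "'v set"
  assumes "random_orientation M G D"
    and "S \<subseteq> pverts G"
  defines "X \<equiv> random_vector (pverts G) (\<lambda>i. indicator (set_leads_to M G D S i))"
  shows "positively_associated_events M (pverts G) (set_leads_to M G D S) \<and>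
    (\<forall>f g. increasing_on_vectors (pverts G) f \<longrightarrow> increasing_on_vectors (pverts G) g \<longrightarrow>
      (\<integral>\<omega>. f (X \<omega>) * g (X \<omega>) \<partial>M) \<ge> (\<integral>\<omega>. f (X \<omega>) \<partial>M) * (\<integral>\<omega>. g (X \<omega>) \<partial>M))"
proof -
  interpret random_orientation M G D by fact
  note correlated = increasing_functions_of_set_leads_to[OF assms(2)]
  have "indicator (set_leads_to M G D S i) \<in> borel_measurable M" for i
    using set_leads_to_event[OF assms(2)] by (rule borel_measurable_indicator)
  with correlated have "positively_associated_events M (pverts G) (set_leads_to M G D S)"
    by (auto simp: positively_associated_events_def positively_associated_def)
  with correlated show ?thesis by (auto simp: X_def)
qed

end
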